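(* Let $R$ be a non-archimedean ordered field and let $a,\delta\in R$ be positive with $\delta\ll a$. Let $\Sigma$ be the $R$-admissible fan in $R^2\times R_{\geq0}$ whose maximal cones are $$\{(x,y,t)\in R^2\times R_{\geq0}\mid x=0,\ y=\delta t\}\quad\text{and}\quad\{(x,y,t)\in R^2\times R_{\geq0}\mid y=0,\ -at\leq x\leq at\}.$$ Then $\Sigma$ has no $R$-admissible completion, i.e. there is no $R$-admissible fan $\overline{\Sigma}$ in $R^2\times R_{\ge0}$ with $\Sigma\subset\overline{\Sigma}$ such that the union of the cones of $\overline{\Sigma}$ is $R^2\times R_{\geq0}$.
   Context: For non-negative $a,b\in R$, $b\ll a$ means $qb<a$ for all positive $q\in\mathbb{Q}$. $R$ is archimedean if for all positive $a,b\in R$ there is a positive $q\in\mathbb{Q}$ with $a\le qb$; otherwise it is non-archimedean. A polyhedral complex in $R^n$ is a finite collection of polyhedra (over $R$), closed under taking faces, such that any two members intersect either in the empty set or in a common face of both. A fan is a nonempty polyhedral complex consisting of strongly convex cones (cones containing no line). A fan in $R^2\times R_{\ge0}$ is a fan in $R^2\times R$ all of whose cones lie in $R^2\times R_{\ge0}$. A cone $\sigma\subset R^2\times R_{\ge0}$ is $R$-admissible if it is strongly convex and can be written as $\sigma=\{(x,y,t)\in R^2\times R_{\ge0}\mid p_ix+q_iy+\gamma_it\ge0\text{ for }i=1,\dots,\ell\}$ with $p_i,q_i\in\mathbb{Z}$ and $\gamma_i\in R$. A fan in $R^2\times R_{\ge0}$ is $R$-admissible if all its cones are. *)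

theory Defs
  imports "HOL-Analysis.Analysis"
begin

section \<open>Ordered fields\<close>

text \<open>The relation is meant for non-negative arguments only.\<close>

definition much_less :: "'a::linordered_field \<Rightarrow> 'a \<Rightarrow> bool" (infix \<open>\<lless>\<close> 50) where
  "b \<lless> a \<longleftrightarrow> (\<forall>q::rat. 0 < q \<longrightarrow> of_rat q * b < a)"

definition archimedean :: "'a::linordered_field itself \<Rightarrow> bool" where
  "archimedean _ \<longleftrightarrow>
     (\<forall>a b::'a. 0 < a \<longrightarrow> 0 < b \<longrightarrow> (\<exists>q::rat. 0 < q \<and> a \<le> of_rat q * b))"

section \<open>Polyhedra, complexes and fans over an ordered field\<close>

text \<open>
  The notions of polyhedron, face and cone in the library are restricted to real vector
  spaces, so the ones needed over an arbitrary ordered field are defined here.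
\<close>

definition is_polyhedron :: "('a::linordered_field ^ 'n) set \<Rightarrow> bool" where
  "is_polyhedron P \<longleftrightarrow>
     (\<exists>H. finite H \<and> P = {v. \<forall>(c, b)\<in>H. b \<le> scalar_product c v})"

definition is_polyhedral_cone :: "('a::linordered_field ^ 'n) set \<Rightarrow> bool" where
  "is_polyhedral_cone C \<longleftrightarrow>
     (\<exists>H. finite H \<and> C = {v. \<forall>c\<in>H. 0 \<le> scalar_product c v})"

definition contains_line :: "('a::linordered_field ^ 'n) set \<Rightarrow> bool" where
  "contains_line P \<longleftrightarrow> (\<exists>p d. d \<noteq> 0 \<and> (\<forall>s. p + s *s d \<in> P))"

definition strongly_convex_cone :: "('a::linordered_field ^ 'n) set \<Rightarrow> bool" where
  "strongly_convex_cone C \<longleftrightarrow> is_polyhedral_cone C \<and> \<not> contains_line C"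

text \<open>
  A face is the nonempty locus where some linear functional attains its minimum on the
  polyhedron. The zero functional makes a nonempty polyhedron a face of itself; the empty
  set is not counted as a face.
\<close>

definition is_face :: "('a::linordered_field ^ 'n) set \<Rightarrow> ('a ^ 'n) set \<Rightarrow> bool" where
  "is_face F P \<longleftrightarrow> F \<noteq> {} \<and>
     (\<exists>c. F = {v\<in>P. \<forall>w\<in>P. scalar_product c v \<le> scalar_product c w})"

definition polyhedral_complex :: "('a::linordered_field ^ 'n) set set \<Rightarrow> bool" where
  "polyhedral_complex K \<longleftrightarrow>
     finite K \<and>
     (\<forall>P\<in>K. is_polyhedron P) \<and>
     (\<forall>P\<in>K. \<forall>F. is_face F P \<longrightarrow> F \<in> K) \<and>
     (\<forall>P\<in>K. \<forall>Q\<in>K. P \<inter> Q = {} \<or> (is_face (P \<inter> Q) P \<and> is_face (P \<inter> Q) Q))"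

definition fan :: "('a::linordered_field ^ 'n) set set \<Rightarrow> bool" where
  "fan \<Sigma> \<longleftrightarrow> \<Sigma> \<noteq> {} \<and> polyhedral_complex \<Sigma> \<and> (\<forall>\<sigma>\<in>\<Sigma>. strongly_convex_cone \<sigma>)"

definition maximal_cones :: "('a::linordered_field ^ 'n) set set \<Rightarrow> ('a ^ 'n) set set" where
  "maximal_cones \<Sigma> = {\<sigma>\<in>\<Sigma>. \<forall>\<tau>\<in>\<Sigma>. \<sigma> \<subseteq> \<tau> \<longrightarrow> \<tau> = \<sigma>}"

section \<open>Admissible fans in the upper half space\<close>

text \<open>
  The space $R^2 \times R$ is the type of vectors of length 3; a point $(x,y,t)$ has
  \<open>x = v $ 1\<close>, \<open>y = v $ 2\<close> and \<open>t = v $ 3\<close>.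
\<close>

definition upper_half_space :: "('a::linordered_field ^ 3) set" where
  "upper_half_space = {v. 0 \<le> v $ 3}"

definition admissible_cone :: "('a::linordered_field ^ 3) set \<Rightarrow> bool" where
  "admissible_cone \<sigma> \<longleftrightarrow> strongly_convex_cone \<sigma> \<and>
     (\<exists>H :: (int \<times> int \<times> 'a) set. finite H \<and>
        \<sigma> = {v\<in>upper_half_space.
               \<forall>(p, q, \<gamma>)\<in>H. 0 \<le> of_int p * v $ 1 + of_int q * v $ 2 + \<gamma> * v $ 3})"

definition admissible_fan :: "('a::linordered_field ^ 3) set set \<Rightarrow> bool" where
  "admissible_fan \<Sigma> \<longleftrightarrow>
     fan \<Sigma> \<and> (\<forall>\<sigma>\<in>\<Sigma>. \<sigma> \<subseteq> upper_half_space) \<and> (\<forall>\<sigma>\<in>\<Sigma>. admissible_cone \<sigma>)"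

definition admissible_completion ::
    "('a::linordered_field ^ 3) set set \<Rightarrow> ('a ^ 3) set set \<Rightarrow> bool" where
  "admissible_completion \<Sigma>' \<Sigma> \<longleftrightarrow>
     admissible_fan \<Sigma>' \<and> \<Sigma> \<subseteq> \<Sigma>' \<and> \<Union>\<Sigma>' = upper_half_space"

definition ray_cone :: "'a::linordered_field \<Rightarrow> ('a ^ 3) set" where
  "ray_cone \<delta> = {v\<in>upper_half_space. v $ 1 = 0 \<and> v $ 2 = \<delta> * v $ 3}"

definition wedge_cone :: "'a::linordered_field \<Rightarrow> ('a ^ 3) set" where
  "wedge_cone a =
     {v\<in>upper_half_space. v $ 2 = 0 \<and> - (a * v $ 3) \<le> v $ 1 \<and> v $ 1 \<le> a * v $ 3}"

section \<open>The fan with maximal cones \<open>ray_cone\<close> and \<open>wedge_cone\<close>\<close>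

lemma scalar_product_3:
  "scalar_product c (v::'a::linordered_field^3) = c $ 1 * v $ 1 + c $ 2 * v $ 2 + c $ 3 * v $ 3"
  by (simp add: scalar_product_def sum_3)

lemma scalar_product_smult:
  "scalar_product c (s *s v) = s * scalar_product (c::'a::linordered_field^'n) v"
  by (simp add: scalar_product_def sum_distrib_left algebra_simps)

lemma is_polyhedron_cone:
  fixes C :: "('a::linordered_field ^ 'n) set"
  assumes "is_polyhedral_cone C"
  shows "is_polyhedron C"
proof -
  from assms obtain H where H: "finite H" "C = {v. \<forall>c\<in>H. 0 \<le> scalar_product c v}"
    unfolding is_polyhedral_cone_def by blast
  show ?thesis
    unfolding is_polyhedron_def
    by (rule exI[of _ "(\<lambda>c. (c, 0)) ` H"]) (use H in auto)
qed

lemma is_face_cone_iff: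
  fixes C :: "('a::linordered_field ^ 'n) set"
  assumes "is_polyhedral_cone C"
  shows "is_face F C \<longleftrightarrow>
    (\<exists>c. (\<forall>v\<in>C. 0 \<le> scalar_product c v) \<and> F = {v\<in>C. scalar_product c v = 0})"
proof -
  from assms obtain H where H: "C = {v. \<forall>c\<in>H. 0 \<le> scalar_product c v}"
    unfolding is_polyhedral_cone_def by blast
  have z: "0 \<in> C" unfolding H by (simp add: scalar_product_def)
  have s0: "scalar_product c (0::'a^'n) = 0" for c by (simp add: scalar_product_def)
  have sm: "s *s v \<in> C" if "v \<in> C" "0 \<le> s" for s v
    using that unfolding H by (simp add: scalar_product_smult)
  show ?thesis
  proof
    assume "is_face F C"
    then obtain c v where c: "F = {v\<in>C. \<forall>w\<in>C. scalar_product c v \<le> scalar_product c w}"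
      and v: "v \<in> F" unfolding is_face_def by blast
    have le: "scalar_product c v \<le> scalar_product c w" if "w \<in> C" for w
      using v that unfolding c by blast
    have vC: "v \<in> C" using v c by blast
    have "scalar_product c v \<le> 2 * scalar_product c v"
      using le[OF sm[OF vC, of 2]] by (simp add: scalar_product_smult)
    moreover have "scalar_product c v \<le> 0" using le[OF z] by (simp add: s0)
    ultimately have v0: "scalar_product c v = 0" by linarith
    show "\<exists>c. (\<forall>v\<in>C. 0 \<le> scalar_product c v) \<and> F = {v\<in>C. scalar_product c v = 0}"
    proof (intro exI conjI)
      show "\<forall>v\<in>C. 0 \<le> scalar_product c v" using le v0 by simp
      then show "F = {v\<in>C. scalar_product c v = 0}"
        unfolding c using z s0 by (auto intro: order_antisym) (metis order_antisym)
    qed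
  next
    assume "\<exists>c. (\<forall>v\<in>C. 0 \<le> scalar_product c v) \<and> F = {v\<in>C. scalar_product c v = 0}"
    then obtain c where c: "\<And>v. v\<in>C \<Longrightarrow> 0 \<le> scalar_product c v"
      "F = {v\<in>C. scalar_product c v = 0}" by blast
    have "F = {v\<in>C. \<forall>w\<in>C. scalar_product c v \<le> scalar_product c w}"
      unfolding c(2) using z s0 c(1) by (auto intro: order_antisym) (metis order_antisym)
    moreover have "F \<noteq> {}" using z s0 c(2) by auto
    ultimately show "is_face F C" unfolding is_face_def by blast
  qed
qed

lemma admissible_coneI:
  fixes C :: "('a::linordered_field ^ 3) set"
  assumes fin: "finite H"
    and C: "C = {v\<in>upper_half_space.
       \<forall>(p, q, \<gamma>)\<in>H. 0 \<le> of_int p * v $ 1 + of_int q * v $ 2 + \<gamma> * v $ 3}"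
    and bd: "\<And>v. v \<in> C \<Longrightarrow> \<bar>v $ 1\<bar> \<le> m * v $ 3 \<and> \<bar>v $ 2\<bar> \<le> m * v $ 3"
  shows "admissible_cone C"
proof -
  let ?H = "insert (vector [0,0,1])
    ((\<lambda>(p, q, \<gamma>). vector [of_int p, of_int q, \<gamma>] :: 'a^3) ` H)"
  have "C = {v. \<forall>c\<in>?H. 0 \<le> scalar_product c v}"
    unfolding C upper_half_space_def by (auto simp: scalar_product_3 split_beta)
  moreover have "finite ?H" using fin by simp
  ultimately have pc: "is_polyhedral_cone C"
    unfolding is_polyhedral_cone_def by (intro exI[of _ ?H] conjI)
  have zero: "x = 0" if "\<And>s. 0 \<le> y + s * x" for x y :: 'a
  proof (rule ccontr)
    assume "x \<noteq> 0"
    then show False using that[of "- (y + 1) / x"] by simp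
  qed
  have "\<not> contains_line C"
  proof
    assume "contains_line C"
    then obtain p d where d: "d \<noteq> 0" and l: "\<And>s. p + s *s d \<in> C"
      unfolding contains_line_def by blast
    have "0 \<le> p $ 3 + s * d $ 3" for s
      using l[of s] unfolding C upper_half_space_def by simp
    then have d3: "d $ 3 = 0" by (rule zero)
    have z1: "0 \<le> (m * p $ 3 - p $ 1) + s * (- d $ 1)" for s
      using bd[OF l[of s]] d3 by (auto simp: abs_le_iff)
    have d1: "d $ 1 = 0" using zero[OF z1] by simp
    have z2: "0 \<le> (m * p $ 3 - p $ 2) + s * (- d $ 2)" for s
      using bd[OF l[of s]] d3 by (auto simp: abs_le_iff)
    have d2: "d $ 2 = 0" using zero[OF z2] by simp
    show False using d d1 d2 d3 by (simp add: vec_eq_iff forall_3)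
  qed
  then show ?thesis unfolding admissible_cone_def strongly_convex_cone_def
    by (intro conjI exI[of _ H]) (rule pc, assumption, rule fin, rule C)
qed

text \<open>The fan of the main statement exists and is determined by its maximal cones.\<close>

lemma ex1_fan_ray_wedge:
  fixes a \<delta> :: "'a::linordered_field"
  assumes a: "0 < a" and \<delta>: "0 < \<delta>"
  shows "\<exists>!\<Sigma>. admissible_fan \<Sigma> \<and> maximal_cones \<Sigma> = {ray_cone \<delta>, wedge_cone a}"
proof -
  define A where "A = ray_cone \<delta>"
  define B where "B = wedge_cone a"
  define P where "P = {v\<in>B. v $ 1 = a * v $ 3}"
  define M where "M = {v\<in>B. v $ 1 = - (a * v $ 3)}"
  define Z where "Z = {0 :: 'a^3}"
  define S where "S = {A, B, P, M, Z}"
  note sets = A_def B_def P_def M_def ray_cone_def wedge_cone_def upper_half_space_def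
  have a0: "a * t = 0 \<longleftrightarrow> t = 0" and d0: "\<delta> * t = 0 \<longleftrightarrow> t = 0"
    and ap: "0 \<le> a * t \<longleftrightarrow> 0 \<le> t" and dp: "0 \<le> \<delta> * t \<longleftrightarrow> 0 \<le> t"
    for t using a \<delta> by (auto simp: zero_le_mult_iff)
  have v0: "v = 0 \<longleftrightarrow> v $ 1 = 0 \<and> v $ 2 = 0 \<and> v $ 3 = 0" for v :: "'a^3"
    by (simp add: vec_eq_iff forall_3)
  have mono: "0 \<le> t \<Longrightarrow> a * t \<le> (a + \<delta>) * t" "0 \<le> t \<Longrightarrow> \<delta> * t \<le> (a + \<delta>) * t"
    "0 \<le> t \<Longrightarrow> 0 \<le> (a + \<delta>) * t" for t
    using a \<delta> by (auto simp: mult_right_mono)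
  have PB: "P \<subseteq> B" and MB: "M \<subseteq> B" by (auto simp: P_def M_def)
  have adm: "admissible_cone A" "admissible_cone B" "admissible_cone P"
    "admissible_cone M" "admissible_cone Z"
  proof -
    show "admissible_cone A"
    proof (rule admissible_coneI[of "{(1,0,0),(-1,0,0),(0,1,-\<delta>),(0,-1,\<delta>)}" _ "a+\<delta>"])
      fix v assume "v \<in> A"
      then show "\<bar>v $ 1\<bar> \<le> (a + \<delta>) * v $ 3 \<and> \<bar>v $ 2\<bar> \<le> (a + \<delta>) * v $ 3"
        using mono[of "v $ 3"] dp[of "v $ 3"] by (auto simp: sets)
    qed (auto simp: sets)
    have B: "\<bar>v $ 1\<bar> \<le> (a + \<delta>) * v $ 3 \<and> \<bar>v $ 2\<bar> \<le> (a + \<delta>) * v $ 3" if "v \<in> B" for v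
      using that mono[of "v $ 3"] by (auto simp: sets abs_le_iff)
    show "admissible_cone B"
      by (rule admissible_coneI[of "{(0,1,0),(0,-1,0),(1,0,a),(-1,0,a)}" _ "a+\<delta>"])
        (use B in \<open>auto simp: sets\<close>)
    show "admissible_cone P"
    proof (rule admissible_coneI[of "{(0,1,0),(0,-1,0),(1,0,-a),(-1,0,a)}" _ "a+\<delta>"])
      show "P = {v\<in>upper_half_space. \<forall>(p, q, \<gamma>)\<in>{(0,1,0),(0,-1,0),(1,0,-a),(-1,0,a)}.
        0 \<le> of_int p * v $ 1 + of_int q * v $ 2 + \<gamma> * v $ 3}"
      proof (rule set_eqI)
        fix v
        show "v \<in> P \<longleftrightarrow> v \<in> {v\<in>upper_half_space.
          \<forall>(p, q, \<gamma>)\<in>{(0,1,0),(0,-1,0),(1,0,-a),(-1,0,a)}.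
          0 \<le> of_int p * v $ 1 + of_int q * v $ 2 + \<gamma> * v $ 3}"
          using ap[of "v $ 3"] by (auto simp: sets)
      qed
    qed (simp, use B PB in blast)
    show "admissible_cone M"
    proof (rule admissible_coneI[of "{(0,1,0),(0,-1,0),(1,0,a),(-1,0,-a)}" _ "a+\<delta>"])
      show "M = {v\<in>upper_half_space. \<forall>(p, q, \<gamma>)\<in>{(0,1,0),(0,-1,0),(1,0,a),(-1,0,-a)}.
        0 \<le> of_int p * v $ 1 + of_int q * v $ 2 + \<gamma> * v $ 3}"
      proof (rule set_eqI)
        fix v
        show "v \<in> M \<longleftrightarrow> v \<in> {v\<in>upper_half_space.
          \<forall>(p, q, \<gamma>)\<in>{(0,1,0),(0,-1,0),(1,0,a),(-1,0,-a)}.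
          0 \<le> of_int p * v $ 1 + of_int q * v $ 2 + \<gamma> * v $ 3}"
          using ap[of "v $ 3"] by (auto simp: sets)
      qed
    qed (simp, use B MB in blast)
    show "admissible_cone Z"
      by (rule admissible_coneI[of "{(1,0,0),(-1,0,0),(0,1,0),(0,-1,0),(0,0,-1)}" _ 0])
        (auto simp: Z_def upper_half_space_def v0)
  qed
  then have pcS: "is_polyhedral_cone C" if "C \<in> S" for C
    using that by (auto simp: S_def admissible_cone_def strongly_convex_cone_def)
  have faceS: "is_face F C \<longleftrightarrow>
    (\<exists>c. (\<forall>v\<in>C. 0 \<le> scalar_product c v) \<and> F = {v\<in>C. scalar_product c v = 0})"
    if "C \<in> S" for F C using is_face_cone_iff[OF pcS[OF that]] .
  have zin: "0 \<in> C" if "C \<in> S" for C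
    using that by (auto simp: S_def Z_def sets)
  have inS: "A \<in> S" "B \<in> S" "P \<in> S" "M \<in> S" "Z \<in> S" by (auto simp: S_def)
  have eA: "vector [0, \<delta>, 1] \<in> A" by (simp add: sets)
  have eP: "vector [a, 0, 1] \<in> P" and eM: "vector [-a, 0, 1] \<in> M"
    using a by (simp_all add: sets)
  have fZ: "is_face Z C" if "C \<in> S" for C
  proof -
    have C3: "0 \<le> v $ 3 \<and> (v $ 3 = 0 \<longrightarrow> v = 0)" if "v \<in> C" for v
      using that \<open>C \<in> S\<close> by (auto simp: S_def Z_def sets v0)
    show ?thesis
      unfolding faceS[OF that]
      by (rule exI[of _ "vector [0,0,1]"])
        (use C3 zin[OF that] in \<open>auto simp: Z_def scalar_product_3\<close>)
  qed
  have fI: "is_face C C" if "C \<in> S" for C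
    unfolding faceS[OF that] by (rule exI[of _ 0]) (auto simp: scalar_product_def)
  have fP: "is_face P B" unfolding faceS[OF inS(2)]
    by (rule exI[of _ "vector [-1,0,a]"]) (auto simp: sets scalar_product_3)
  have fM: "is_face M B" unfolding faceS[OF inS(2)]
    by (rule exI[of _ "vector [1,0,a]"]) (auto simp: sets scalar_product_3)
  have fine: "F = C \<or> F = Z" if F: "is_face F C" and C: "C \<in> S" "e \<in> C"
    and gen: "\<And>v. v \<in> C \<Longrightarrow> v = v $ 3 *s e" for F C e
  proof -
    obtain c where c: "F = {v\<in>C. scalar_product c v = 0}" using F unfolding faceS[OF C(1)] by blast
    have sp: "scalar_product c v = v $ 3 * scalar_product c e" if "v \<in> C" for v
      using gen[OF that] scalar_product_smult by metis
    show ?thesis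
    proof (cases "scalar_product c e = 0")
      case True
      then show ?thesis using c sp by auto
    next
      case False
      have "v = 0" if "v \<in> F" for v
      proof -
        have "v \<in> C" "scalar_product c v = 0" using that c by auto
        then have "v $ 3 = 0" using sp False by simp
        then show "v = 0" using gen[OF \<open>v \<in> C\<close>] by simp
      qed
      moreover have "0 \<in> F" using zin[OF C(1)] c by (simp add: scalar_product_def)
      ultimately show ?thesis by (auto simp: Z_def)
    qed
  qed
  have fA: "F = A \<or> F = Z" if "is_face F A" for F
    by (rule fine[OF that inS(1) eA]) (auto simp: sets vec_eq_iff forall_3)
  have fP': "F = P \<or> F = Z" if "is_face F P" for F
    by (rule fine[OF that inS(3) eP]) (auto simp: sets vec_eq_iff forall_3)
  have fM': "F = M \<or> F = Z" if "is_face F M" for F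
    by (rule fine[OF that inS(4) eM]) (auto simp: sets vec_eq_iff forall_3)
  have fZ': "F = Z" if "is_face F Z" for F
    using that by (auto simp: is_face_def Z_def)
  have fB: "F = B \<or> F = P \<or> F = M \<or> F = Z" if FB: "is_face F B" for F
  proof -
    obtain c where nn': "\<forall>v\<in>B. 0 \<le> scalar_product c v"
      and F: "F = {v\<in>B. scalar_product c v = 0}" using FB unfolding faceS[OF inS(2)] by blast
    have nn: "0 \<le> scalar_product c v" if "v \<in> B" for v using nn' that by blast
    define u where "u = c $ 1 * a + c $ 3"
    define w where "w = c $ 3 - c $ 1 * a"
    have u0: "0 \<le> u" using nn[of "vector [a,0,1]"] eP PB
      by (auto simp: scalar_product_3 u_def)
    have w0: "0 \<le> w" using nn[of "vector [-a,0,1]"] eM MB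
      by (auto simp: scalar_product_3 w_def)
    have sp: "scalar_product c v = 0 \<longleftrightarrow>
        (u = 0 \<or> v $ 1 = - (a * v $ 3)) \<and> (w = 0 \<or> v $ 1 = a * v $ 3)"
      if v: "v \<in> B" for v
    proof -
      have e: "2 * a * scalar_product c v =
          u * (v $ 1 + a * v $ 3) + w * (a * v $ 3 - v $ 1)"
        using v by (simp add: scalar_product_3 sets u_def w_def algebra_simps)
      have n: "0 \<le> u * (v $ 1 + a * v $ 3)" "0 \<le> w * (a * v $ 3 - v $ 1)"
        using v u0 w0 by (auto simp: sets intro!: mult_nonneg_nonneg)
      have "scalar_product c v = 0 \<longleftrightarrow> 2 * a * scalar_product c v = 0" using a by simp
      also have "\<dots> \<longleftrightarrow> u * (v $ 1 + a * v $ 3) = 0 \<and> w * (a * v $ 3 - v $ 1) = 0"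
        unfolding e using n by (rule add_nonneg_eq_0_iff)
      also have "\<dots> \<longleftrightarrow> (u = 0 \<or> v $ 1 = - (a * v $ 3)) \<and> (w = 0 \<or> v $ 1 = a * v $ 3)"
        by (auto simp: eq_neg_iff_add_eq_0)
      finally show ?thesis .
    qed
    have F': "F = {v\<in>B. (u = 0 \<or> v $ 1 = - (a * v $ 3)) \<and> (w = 0 \<or> v $ 1 = a * v $ 3)}"
      unfolding F using sp by auto
    have Z': "{v\<in>B. v $ 1 = - (a * v $ 3) \<and> v $ 1 = a * v $ 3} = Z"
      using a by (auto simp: sets Z_def v0)
    show ?thesis
      by (cases "u = 0"; cases "w = 0") (use Z' F' in \<open>auto simp: P_def M_def\<close>)
  qed
  have I: "A \<inter> B = Z" "A \<inter> P = Z" "A \<inter> M = Z" "P \<inter> M = Z"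
    "B \<inter> P = P" "B \<inter> M = M"
    using a \<delta> by (auto simp: sets Z_def v0)
  have IZ: "C \<inter> Z = Z" "Z \<inter> C = Z" if "C \<in> S" for C
    using zin[OF that] by (auto simp: Z_def)
  have I': "B \<inter> A = Z" "P \<inter> A = Z" "M \<inter> A = Z" "M \<inter> P = Z" "P \<inter> B = P" "M \<inter> B = M"
    using I by blast+
  have inter: "is_face (C \<inter> D) C \<and> is_face (C \<inter> D) D" if "C \<in> S" "D \<in> S" for C D
    using that unfolding S_def
    by (elim insertE emptyE) (simp_all add: I I' IZ inS fZ fI fP fM)
  have "polyhedral_complex S"
    unfolding polyhedral_complex_def
  proof (intro conjI ballI allI impI)
    show "finite S" by (simp add: S_def)
    show "is_polyhedron C" if "C \<in> S" for C using is_polyhedron_cone[OF pcS[OF that]] .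
    show "F \<in> S" if "C \<in> S" "is_face F C" for C F
      using that fA fB fP' fM' fZ' unfolding S_def by blast
    show "C \<inter> D = {} \<or> is_face (C \<inter> D) C \<and> is_face (C \<inter> D) D" if "C \<in> S" "D \<in> S" for C D
      using inter[OF that] by blast
  qed
  then have fan: "admissible_fan S"
    unfolding admissible_fan_def fan_def
    using adm by (auto simp: S_def admissible_cone_def)
  have AB: "\<not> A \<subseteq> B" "\<not> B \<subseteq> A" "\<not> B \<subseteq> P" "\<not> B \<subseteq> M" "\<not> B \<subseteq> Z"
    "\<not> A \<subseteq> P" "\<not> A \<subseteq> M" "\<not> A \<subseteq> Z"
  proof -
    have e: "vector [0, \<delta>, 1] \<notin> B" using \<delta> by (simp add: sets)
    show "\<not> A \<subseteq> B" using eA e by blast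
    then show "\<not> A \<subseteq> P" "\<not> A \<subseteq> M" using PB MB by blast+
    show "\<not> A \<subseteq> Z" using eA by (auto simp: Z_def v0)
    have e0: "vector [0, 0, 1] \<in> B" using a by (simp add: sets)
    show "\<not> B \<subseteq> A" "\<not> B \<subseteq> P" "\<not> B \<subseteq> M" "\<not> B \<subseteq> Z"
      using subsetD[OF _ e0, of A] subsetD[OF _ e0, of P] subsetD[OF _ e0, of M]
        subsetD[OF _ e0, of Z] a \<delta>
      by (auto simp: sets Z_def v0)
  qed
  have "Z \<subseteq> A" using zin[OF inS(1)] by (simp add: Z_def)
  have sub: "C \<subseteq> A \<or> C \<subseteq> B" if "C \<in> S" for C
    using that PB MB \<open>Z \<subseteq> A\<close> by (auto simp: S_def)
  have "C = A \<or> C = B" if "C \<in> maximal_cones S" for C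
  proof -
    have "C \<in> S" "\<And>D. D \<in> S \<Longrightarrow> C \<subseteq> D \<Longrightarrow> D = C"
      using that by (simp_all add: maximal_cones_def)
    then show ?thesis using sub[of C] inS(1,2) by metis
  qed
  moreover have "A \<in> maximal_cones S" "B \<in> maximal_cones S"
    using AB by (auto simp: maximal_cones_def S_def)
  ultimately have max: "maximal_cones S = {A, B}"
    by blast
  have uniq: "T = S" if T: "admissible_fan T" and m: "maximal_cones T = {A, B}" for T
  proof -
    have pc: "polyhedral_complex T" using T by (simp add: admissible_fan_def fan_def)
    have "A \<in> maximal_cones T" "B \<in> maximal_cones T" unfolding m by simp_all
    then have AT: "A \<in> T" "B \<in> T" by (simp_all add: maximal_cones_def)
    have "S \<subseteq> T"
      using pc AT fZ[OF inS(1)] fP fM unfolding polyhedral_complex_def S_def by blast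
    moreover have "C \<in> S" if C: "C \<in> T" for C
    proof -
      have "finite T" using pc by (simp add: polyhedral_complex_def)
      then obtain D where D: "D \<in> T" "C \<subseteq> D" "\<And>E. E \<in> T \<Longrightarrow> D \<subseteq> E \<Longrightarrow> D = E"
        using finite_has_maximal2[OF _ C] by metis
      then have "D \<in> maximal_cones T" by (auto simp: maximal_cones_def)
      then have DAB: "D = A \<or> D = B" unfolding m by simp
      have "0 \<in> C" using T C
        by (auto simp: admissible_fan_def admissible_cone_def upper_half_space_def)
      then have "is_face (C \<inter> D) D"
        using pc C D(1,2) unfolding polyhedral_complex_def by blast
      moreover have "C \<inter> D = C" using D(2) by blast
      ultimately have "is_face C D" by simp
      with DAB show "C \<in> S" using fA[of C] fB[of C] inS by blast
    qed
    ultimately show ?thesis by blast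
  qed
  show ?thesis
    unfolding A_def[symmetric] B_def[symmetric]
  proof (rule ex1I)
    show "admissible_fan S \<and> maximal_cones S = {A, B}" using fan max ..
    show "T = S" if "admissible_fan T \<and> maximal_cones T = {A, B}" for T
      by (rule uniq) (rule conjunct1[OF that], rule conjunct2[OF that])
  qed
qed

end

theory Submission
  imports Defs
begin

text \<open>
  Work in the slice \<open>t = 1\<close>, where the walls of admissible cones have rational or infinite slopes.
  A cell that contains a centred horizontal segment of half-width \<open>b\<close> with \<open>\<delta> \<lless> b\<close> at some
  height in \<open>[0,\<delta>]\<close> and also contains a point \<open>(0,y)\<close> with \<open>y \<in> [0,\<delta>]\<close> must contain the centred
  horizontal segment of half-width \<open>b/2\<close> at height \<open>y\<close>: a wall of nonzero rational slope
  rises by far more than \<open>\<delta>\<close> over a width of \<open>b/2\<close>. Hence \<open>(0,\<delta>)\<close> is not a vertex of such a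
  cell, and, if the cell ends below \<open>(0,\<delta>)\<close>, its upper edge over \<open>x = 0\<close> is horizontal and wide
  again. Starting from the wedge, this gives an infinite ascending ladder of horizontal edges below
  \<open>(0,\<delta>)\<close>, contradicting finiteness.
\<close>

section \<open>Infinitesimal multiples\<close>

lemma much_less_of_int:
  fixes b \<delta> :: "'a::linordered_field"
  assumes "\<delta> \<lless> b" and "0 < n"
  shows "of_int n * \<delta> < b"
  using assms unfolding much_less_def by (metis of_int_0_less_iff of_rat_of_int_eq)

text \<open>Each rung of the ladder is half as wide as the one before, so the relation has to
  survive halving.\<close>

lemma much_less_half:
  fixes b \<delta> :: "'a::linordered_field"
  assumes "\<delta> \<lless> b"
  shows "\<delta> \<lless> b / 2"
  unfolding much_less_def
proof (intro allI impI)
  fix q :: rat assume "0 < q"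
  then have "of_rat (2 * q) * \<delta> < b"
    using assms unfolding much_less_def by (metis mult_pos_pos zero_less_numeral)
  then show "of_rat q * \<delta> < b / 2" by (simp add: of_rat_mult)
qed

lemma scalar_product_slice:
  "scalar_product c (vector [x, y, 1] :: 'a::linordered_field^3) = c $ 1 * x + c $ 2 * y + c $ 3"
  by (simp add: scalar_product_3)

section \<open>Polyhedral cones and fans over an ordered field\<close>

text \<open>A constraint violated at \<open>v\<close> has a positive deficit there, and a short
  enough move along \<open>d\<close> cannot make up for it. This is openness of the complement in
  elementary form.\<close>

lemma polyhedral_cone_avoid:
  fixes C :: "('a::linordered_field ^ 'n) set"
  assumes "is_polyhedral_cone C" and "v \<notin> C"
  shows "\<exists>\<epsilon>>0. \<forall>s. 0 < s \<and> s \<le> \<epsilon> \<longrightarrow> v + s *s d \<notin> C"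
proof -
  obtain H where C: "C = {v. \<forall>c\<in>H. 0 \<le> scalar_product c v}"
    using assms(1) unfolding is_polyhedral_cone_def by blast
  then obtain c where c: "c \<in> H" "scalar_product c v < 0" using assms(2) by force
  \<comment> \<open>The \<open>+ 1\<close> avoids a zero denominator and leaves the surplus
    \<open>\<epsilon>\<close> that makes the final inequality strict.\<close>
  define \<epsilon> where "\<epsilon> = - scalar_product c v / (\<bar>scalar_product c d\<bar> + 1)"
  have pos: "0 < \<bar>scalar_product c d\<bar> + 1" by (simp add: add_nonneg_pos)
  have \<epsilon>: "0 < \<epsilon>" "\<epsilon> * (\<bar>scalar_product c d\<bar> + 1) = - scalar_product c v"
    using c(2) pos by (auto simp: \<epsilon>_def divide_neg_pos)
  have "v + s *s d \<notin> C" if s: "0 < s" "s \<le> \<epsilon>" for s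
  proof -
    have "s * scalar_product c d \<le> s * \<bar>scalar_product c d\<bar>"
      using s by (intro mult_left_mono) auto
    also have "\<dots> \<le> \<epsilon> * \<bar>scalar_product c d\<bar>" using s by (intro mult_right_mono) auto
    finally have "scalar_product c v + s * scalar_product c d < 0"
      using \<epsilon> by (simp add: algebra_simps)
    moreover have "scalar_product c (v + s *s d) = scalar_product c v + s * scalar_product c d"
      by (simp add: scalar_product_def sum.distrib sum_distrib_left algebra_simps)
    ultimately show ?thesis using c(1) C by force
  qed
  then show ?thesis using \<epsilon>(1) by blast
qed

lemma finite_common_threshold:
  fixes Q :: "'b \<Rightarrow> 'a::linordered_field \<Rightarrow> bool"
  assumes "finite S" and "\<And>\<sigma>. \<sigma> \<in> S \<Longrightarrow> \<exists>\<epsilon>>0. \<forall>s. 0 < s \<and> s \<le> \<epsilon> \<longrightarrow> Q \<sigma> s"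
  shows "\<exists>\<epsilon>>0. \<forall>\<sigma>\<in>S. \<forall>s. 0 < s \<and> s \<le> \<epsilon> \<longrightarrow> Q \<sigma> s"
  using assms
proof (induction rule: finite_induct)
  case empty
  show ?case using zero_less_one by blast
next
  case (insert \<tau> S)
  obtain \<epsilon> where e: "\<epsilon> > 0" "\<forall>\<sigma>\<in>S. \<forall>s. 0 < s \<and> s \<le> \<epsilon> \<longrightarrow> Q \<sigma> s" using insert by auto
  obtain \<epsilon>' where e': "\<epsilon>' > 0" "\<forall>s. 0 < s \<and> s \<le> \<epsilon>' \<longrightarrow> Q \<tau> s" using insert.prems by blast
  show ?case by (rule exI[of _ "min \<epsilon> \<epsilon>'"]) (use e e' in auto)
qed

lemma fan_finite: "fan \<Sigma> \<Longrightarrow> finite \<Sigma>"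
  by (simp add: fan_def polyhedral_complex_def)

lemma fan_polyhedral_cone: "fan \<Sigma> \<Longrightarrow> \<sigma> \<in> \<Sigma> \<Longrightarrow> is_polyhedral_cone \<sigma>"
  by (simp add: fan_def strongly_convex_cone_def)

lemma fan_face_mem:
  assumes "fan \<Sigma>" and "\<sigma> \<in> \<Sigma>" and "\<And>v. v \<in> \<sigma> \<Longrightarrow> 0 \<le> scalar_product c v"
  shows "{v\<in>\<sigma>. scalar_product c v = 0} \<in> \<Sigma>"
proof -
  have "is_face {v\<in>\<sigma>. scalar_product c v = 0} \<sigma>"
    unfolding is_face_cone_iff[OF fan_polyhedral_cone[OF assms(1,2)]] using assms(3) by blast
  then show ?thesis using assms(1,2) by (auto simp: fan_def polyhedral_complex_def)
qed

lemma fan_inter_face: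
  assumes "fan \<Sigma>" and "\<sigma> \<in> \<Sigma>" and "\<tau> \<in> \<Sigma>" and "v \<in> \<sigma>" and "v \<in> \<tau>"
  obtains c where "\<And>v. v \<in> \<sigma> \<Longrightarrow> 0 \<le> scalar_product c v"
    and "\<sigma> \<inter> \<tau> = {v\<in>\<sigma>. scalar_product c v = 0}"
proof -
  have "\<sigma> \<inter> \<tau> = {} \<or> is_face (\<sigma> \<inter> \<tau>) \<sigma>"
    using assms(1-3) unfolding fan_def polyhedral_complex_def by blast
  then have "is_face (\<sigma> \<inter> \<tau>) \<sigma>" using assms(4,5) by blast
  then show thesis
    unfolding is_face_cone_iff[OF fan_polyhedral_cone[OF assms(1,2)]] using that by blast
qed

text \<open>A face that contains an interior point of a segment contains the whole segment.\<close>

lemma fan_midpoint_mem: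
  fixes \<Sigma> :: "('a::linordered_field ^ 3) set set"
  assumes "fan \<Sigma>" and "\<sigma> \<in> \<Sigma>" and "\<tau> \<in> \<Sigma>"
    and "vector [0, h, 1] \<in> \<sigma>" and "vector [0, h, 1] \<in> \<tau>"
    and "vector [- b, h, 1] \<in> \<sigma>" and "vector [b, h, 1] \<in> \<sigma>"
  shows "vector [- b, h, 1] \<in> \<tau>" and "vector [b, h, 1] \<in> \<tau>"
proof -
  obtain c where c: "\<And>v. v \<in> \<sigma> \<Longrightarrow> 0 \<le> scalar_product c v"
    and F: "\<sigma> \<inter> \<tau> = {v\<in>\<sigma>. scalar_product c v = 0}"
    using fan_inter_face[OF assms(1-5)] by blast
  have "scalar_product c (vector [0, h, 1]) = 0" using F assms(4,5) by blast
  then have "c $ 2 * h + c $ 3 = 0" by (simp add: scalar_product_slice)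
  moreover have "0 \<le> - (c $ 1 * b) + c $ 2 * h + c $ 3" "0 \<le> c $ 1 * b + c $ 2 * h + c $ 3"
    using c[OF assms(6)] c[OF assms(7)] by (simp_all add: scalar_product_slice)
  ultimately have "c $ 1 * b = 0" "c $ 2 * h + c $ 3 = 0" by linarith+
  then have "scalar_product c (vector [- b, h, 1]) = 0"
    "scalar_product c (vector [b, h, 1]) = 0"
    unfolding scalar_product_slice mult_minus_right by linarith+
  then show "vector [- b, h, 1] \<in> \<tau>" "vector [b, h, 1] \<in> \<tau>"
    using F assms(6,7) by blast+
qed

section \<open>Wide cells in the slice \<open>t = 1\<close>\<close>

lemma slice_mem_iff:
  "vector [x, y, 1] \<in> {v\<in>upper_half_space.
       \<forall>(p, q, \<gamma>)\<in>H. 0 \<le> of_int p * v $ 1 + of_int q * v $ 2 + \<gamma> * v $ 3} \<longleftrightarrow>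
     (\<forall>p q (\<gamma>::'a::linordered_field). (p, q, \<gamma>) \<in> H \<longrightarrow> 0 \<le> of_int p * x + of_int q * y + \<gamma>)"
  by (auto simp: upper_half_space_def)

text \<open>If \<open>p \<noteq> 0\<close>, validity at both ends of the segment gives slack at
  least \<open>\<bar>p\<bar> * b\<close> at its midpoint. Since \<open>p\<close> is an integer, this
  is at least \<open>b\<close>, and the change of height uses up less than half of it. If
  \<open>p = 0\<close>, the constraint does not see the width.\<close>

lemma admissible_cone_wide:
  fixes b \<delta> :: "'a::linordered_field"
  assumes adm: "admissible_cone \<sigma>" and b: "\<delta> \<lless> b" "0 < \<delta>"
    and seg: "vector [- b, h, 1] \<in> \<sigma>" "vector [b, h, 1] \<in> \<sigma>"
    and y: "vector [0, y, 1] \<in> \<sigma>" "\<bar>y - h\<bar> \<le> \<delta>"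
  shows "vector [- (b / 2), y, 1] \<in> \<sigma>" and "vector [b / 2, y, 1] \<in> \<sigma>"
proof -
  obtain H :: "(int \<times> int \<times> 'a) set" where H0: "finite H"
    "\<sigma> = {v\<in>upper_half_space.
       \<forall>(p, q, \<gamma>)\<in>H. 0 \<le> of_int p * v $ 1 + of_int q * v $ 2 + \<gamma> * v $ 3}"
    using adm unfolding admissible_cone_def by blast
  note H = slice_mem_iff[of _ _ H, folded H0(2)]
  have b0: "0 < b" using much_less_of_int[OF b(1), of 1] b(2) by simp
  have *: "\<bar>of_int p * (b / 2)\<bar> \<le> of_int q * y + \<gamma>" if "(p, q, \<gamma>) \<in> H" for p q \<gamma>
  proof (cases "p = 0")
    case True
    have "0 \<le> of_int p * 0 + of_int q * y + \<gamma>" using y(1) that unfolding H by blast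
    then show ?thesis using True by simp
  next
    case False
    have "0 \<le> of_int p * (- b) + of_int q * h + \<gamma>" "0 \<le> of_int p * b + of_int q * h + \<gamma>"
      using seg that unfolding H by blast+
    then have 1: "\<bar>of_int p * b\<bar> \<le> of_int q * h + \<gamma>" by (simp add: abs_le_iff)
    have "\<bar>of_int q * (y - h)\<bar> \<le> of_int \<bar>q\<bar> * \<delta>"
      using y(2) unfolding abs_mult of_int_abs by (intro mult_left_mono) auto
    \<comment> \<open>The \<open>+ 1\<close> keeps the multiplier positive when
      \<open>q = 0\<close>.\<close>
    moreover have "of_int (2 * \<bar>q\<bar> + 1) * \<delta> < b"
      by (rule much_less_of_int[OF b(1)]) simp
    moreover have "1 \<le> \<bar>of_int p :: 'a\<bar>"
      using False by (metis abs_ge_zero linorder_not_less of_int_1_le_iff of_int_abs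
          zero_less_abs_iff int_one_le_iff_zero_less)
    then have "b \<le> \<bar>of_int p * b\<bar>" using b0 by (simp add: abs_mult)
    ultimately have "2 * \<bar>of_int q * (y - h)\<bar> \<le> \<bar>of_int p * b\<bar>"
      using b(2) by (simp add: algebra_simps)
    moreover have "\<bar>of_int p * (b / 2)\<bar> * 2 = \<bar>of_int p * b\<bar>" by (simp add: abs_mult)
    moreover have "of_int q * y + \<gamma> = (of_int q * h + \<gamma>) + of_int q * (y - h)"
      by (simp add: algebra_simps)
    moreover have "- \<bar>of_int q * (y - h)\<bar> \<le> of_int q * (y - h)" by simp
    ultimately show ?thesis using 1 by linarith
  qed
  have "0 \<le> of_int p * (- (b / 2)) + of_int q * y + \<gamma>"
    "0 \<le> of_int p * (b / 2) + of_int q * y + \<gamma>" if "(p, q, \<gamma>) \<in> H" for p q \<gamma>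
    using *[OF that] unfolding abs_le_iff mult_minus_right by linarith+
  then show "vector [- (b / 2), y, 1] \<in> \<sigma>" "vector [b / 2, y, 1] \<in> \<sigma>"
    unfolding H by blast+
qed

section \<open>The ladder of horizontal edges\<close>

text \<open>
  The edges of the ladder; the second clause says that the cell meets the line \<open>x = 0\<close> of the slice
  in a single point, so it determines \<open>h\<close>.
\<close>

definition wide_edge :: "'a::linordered_field \<Rightarrow> ('a ^ 3) set \<Rightarrow> 'a \<Rightarrow> bool" where
  "wide_edge \<delta> E h \<longleftrightarrow>
     (\<exists>b. \<delta> \<lless> b \<and> vector [- b, h, 1] \<in> E \<and> vector [b, h, 1] \<in> E) \<and>
     (\<forall>y. vector [0, y, 1] \<in> E \<longleftrightarrow> y = h)"

lemma wide_edge_higher: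
  fixes \<delta> :: "'a::linordered_field"
  assumes fan: "admissible_fan \<Sigma>" and cover: "\<Union>\<Sigma> = upper_half_space"
    and ray: "ray_cone \<delta> \<in> \<Sigma>" and \<delta>: "0 < \<delta>"
    and E: "E \<in> \<Sigma>" "wide_edge \<delta> E h" and h: "0 \<le> h" "h < \<delta>"
  obtains F h' where "F \<in> \<Sigma>" and "wide_edge \<delta> F h'" and "h < h'" and "h' < \<delta>"
proof -
  have f: "fan \<Sigma>" using fan by (simp add: admissible_fan_def)
  obtain b where b: "\<delta> \<lless> b" "vector [- b, h, 1] \<in> E" "vector [b, h, 1] \<in> E"
    and Eh: "vector [0, h, 1] \<in> E"
    using E(2) unfolding wide_edge_def by blast
  have line: "vector [0, h, 1] + s *s vector [0, 1, 0] = (vector [0, h + s, 1] :: 'a^3)" for s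
    by (simp add: vec_eq_iff forall_3)
  \<comment> \<open>A cone missing \<open>(0,h)\<close> also misses the points just above it, so a
    cone covering a close enough point above must contain \<open>(0,h)\<close>.\<close>
  have near: "\<exists>\<epsilon>>0. \<forall>s. 0 < s \<and> s \<le> \<epsilon> \<longrightarrow> (vector [0, h + s, 1] \<in> \<sigma> \<longrightarrow> vector [0, h, 1] \<in> \<sigma>)"
    if "\<sigma> \<in> \<Sigma>" for \<sigma>
  proof (cases "vector [0, h, 1] \<in> \<sigma>")
    case True
    then show ?thesis using zero_less_one by blast
  next
    case False
    from polyhedral_cone_avoid[OF fan_polyhedral_cone[OF f that] False, of "vector [0, 1, 0]"]
    show ?thesis unfolding line by blast
  qed
  from finite_common_threshold[where
      Q = "\<lambda>\<sigma> s. vector [0, h + s, 1] \<in> \<sigma> \<longrightarrow> vector [0, h, 1] \<in> \<sigma>", OF fan_finite[OF f] near]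
  obtain \<epsilon> where \<epsilon>: "\<epsilon> > 0"
    "\<And>\<sigma> s. \<sigma> \<in> \<Sigma> \<Longrightarrow> 0 < s \<Longrightarrow> s \<le> \<epsilon> \<Longrightarrow> vector [0, h + s, 1] \<in> \<sigma> \<Longrightarrow> vector [0, h, 1] \<in> \<sigma>"
    by blast
  \<comment> \<open>Close enough to \<open>h\<close> for the common threshold, and still below
    \<open>\<delta>\<close>.\<close>
  define k where "k = h + min \<epsilon> ((\<delta> - h) / 2)"
  have k: "h < k" "k < \<delta>" using \<epsilon>(1) h by (auto simp: k_def min_def field_simps)
  have "vector [0, k, 1] \<in> \<Union>\<Sigma>" unfolding cover by (simp add: upper_half_space_def)
  then obtain P where P: "P \<in> \<Sigma>" "vector [0, k, 1] \<in> P" by blast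
  have Ph: "vector [0, h, 1] \<in> P"
    by (rule \<epsilon>(2)[OF P(1), of "k - h"]) (use P(2) k in \<open>auto simp: k_def\<close>)
  note seg = fan_midpoint_mem[OF f E(1) P(1) Eh Ph b(2,3)]
  have adm: "admissible_cone P" using fan P(1) by (simp add: admissible_fan_def)
  have wide: "vector [- (b / 2), y, 1] \<in> P" "vector [b / 2, y, 1] \<in> P"
    if "vector [0, y, 1] \<in> P" "h \<le> y" "y \<le> \<delta>" for y
    using admissible_cone_wide[OF adm b(1) \<delta> seg that(1)] that h by auto
  have b0: "0 < b" using much_less_of_int[OF b(1), of 1] \<delta> by simp
  \<comment> \<open>Otherwise \<open>wide\<close> gives a horizontal segment of \<open>P\<close>
    centred on the ray, and the face property would force its ends into the ray.\<close>
  have \<delta>P: "vector [0, \<delta>, 1] \<notin> P"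
  proof
    assume D: "vector [0, \<delta>, 1] \<in> P"
    have R: "vector [0, \<delta>, 1] \<in> ray_cone \<delta>" by (simp add: ray_cone_def upper_half_space_def)
    have "vector [b / 2, \<delta>, 1] \<in> ray_cone \<delta>"
      using fan_midpoint_mem(2)[OF f P(1) ray D R wide[OF D]] h by simp
    then show False using b0 by (simp add: ray_cone_def)
  qed
  obtain H :: "(int \<times> int \<times> 'a) set" where H: "finite H"
    "P = {v\<in>upper_half_space.
       \<forall>(p, q, \<gamma>)\<in>H. 0 \<le> of_int p * v $ 1 + of_int q * v $ 2 + \<gamma> * v $ 3}"
    using adm unfolding admissible_cone_def by blast
  note Hs = slice_mem_iff[of _ _ H, folded H(2)]
  have Pk: "0 \<le> of_int q * k + \<gamma>" if "(p, q, \<gamma>) \<in> H" for p q \<gamma>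
  proof -
    have "0 \<le> of_int p * 0 + of_int q * k + \<gamma>" using P(2) that unfolding Hs by blast
    then show ?thesis by simp
  qed
  txt \<open>The constraints with \<open>q < 0\<close> bound \<open>P\<close> from above; \<open>T\<close> holds their heights over \<open>x = 0\<close>.\<close>
  define T where "T = (\<lambda>(p, q, \<gamma>). - \<gamma> / of_int q) ` {(p, q, \<gamma>)\<in>H. q < 0}"
  have finT: "finite T" unfolding T_def by (intro finite_imageI finite_subset[OF _ H(1)]) auto
  obtain p0 q0 \<gamma>0 where c0: "(p0, q0, \<gamma>0) \<in> H" "of_int q0 * \<delta> + \<gamma>0 < 0"
    using \<delta>P unfolding Hs by (auto simp: not_le)
  \<comment> \<open>A constraint that holds at height \<open>k\<close> and fails at the greater
    height \<open>\<delta>\<close> bounds from above, so \<open>T\<close> is nonempty.\<close>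
  have "of_int q0 * (\<delta> - k) < 0" using c0(2) Pk[OF c0(1)] by (simp add: algebra_simps)
  then have q0: "q0 < 0" using k(2) by (auto simp: mult_less_0_iff)
  then have T0: "- \<gamma>0 / of_int q0 \<in> T" unfolding T_def using c0(1) by force
  define m where "m = Min T"
  have "m \<in> T" unfolding m_def using finT T0 by (intro Min_in) auto
  then obtain p q \<gamma> where c: "(p, q, \<gamma>) \<in> H" "q < 0" "m = - \<gamma> / of_int q"
    unfolding T_def by auto
  have mle: "m \<le> - \<gamma>' / of_int q'" if "(p', q', \<gamma>') \<in> H" "q' < 0" for p' q' \<gamma>'
    unfolding m_def by (rule Min_le[OF finT]) (use that in \<open>force simp: T_def\<close>)
  have qm: "of_int q * m + \<gamma> = 0" using c(2,3) by simp
  have "of_int q * m \<le> of_int q * k" using Pk[OF c(1)] qm by linarith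
  then have km: "k \<le> m" using c(2) by (simp add: mult_le_cancel_left_neg)
  have "m \<le> - \<gamma>0 / of_int q0" by (rule mle[OF c0(1) q0])
  also have "\<dots> < \<delta>"
    unfolding neg_divide_less_eq[OF of_int_less_0_iff[THEN iffD2, OF q0]]
    using c0(2) by (simp add: mult.commute)
  finally have md: "m < \<delta>" .
  \<comment> \<open>Upper bounds hold at \<open>m\<close> by minimality; all other constraints hold
    at \<open>k\<close> and can only gain from \<open>k\<close> up to \<open>m\<close>.\<close>
  have Pm: "vector [0, m, 1] \<in> P"
    unfolding Hs
  proof (intro allI impI)
    fix p' q' \<gamma>' assume i: "(p', q', \<gamma>') \<in> H"
    have "0 \<le> of_int q' * m + \<gamma>'"
    proof (cases "q' < 0")
      case True
      have "- \<gamma>' \<le> m * of_int q'"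
        using mle[OF i True] unfolding neg_le_divide_eq[OF of_int_less_0_iff[THEN iffD2, OF True]] .
      then show ?thesis by (simp add: mult.commute)
    next
      case False
      then have "of_int q' * k \<le> of_int q' * m" using km by (intro mult_left_mono) auto
      then show ?thesis using Pk[OF i] by linarith
    qed
    then show "0 \<le> of_int p' * 0 + of_int q' * m + \<gamma>'" by simp
  qed
  have Pw: "vector [- (b / 2), m, 1] \<in> P" "vector [b / 2, m, 1] \<in> P"
    using wide[OF Pm] k km md by auto
  \<comment> \<open>The constraint is tight at \<open>(0,m)\<close> and valid on both sides of it,
    so it cannot depend on \<open>x\<close>: the wall is horizontal.\<close>
  have "0 \<le> of_int p * (- (b / 2)) + of_int q * m + \<gamma>" "0 \<le> of_int p * (b / 2) + of_int q * m + \<gamma>"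
    using Pw c(1) unfolding Hs by blast+
  then have "of_int p * (b / 2) = 0" using qm unfolding mult_minus_right by linarith
  then have p: "p = 0" using b0 by simp
  define F where "F = {v\<in>P. scalar_product (vector [of_int p, of_int q, \<gamma>]) v = 0}"
  have "0 \<le> scalar_product (vector [of_int p, of_int q, \<gamma>]) v" if "v \<in> P" for v
  proof -
    have "\<forall>(p, q, \<gamma>)\<in>H. 0 \<le> of_int p * v $ 1 + of_int q * v $ 2 + \<gamma> * v $ 3"
      using that unfolding H(2) by simp
    from bspec[OF this c(1)] show ?thesis by (simp add: scalar_product_3)
  qed
  then have "F \<in> \<Sigma>" unfolding F_def by (rule fan_face_mem[OF f P(1)])
  moreover have "wide_edge \<delta> F m"
    unfolding wide_edge_def
  proof (intro conjI allI exI)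
    show "\<delta> \<lless> b / 2" by (rule much_less_half[OF b(1)])
    show "vector [- (b / 2), m, 1] \<in> F" "vector [b / 2, m, 1] \<in> F"
      unfolding F_def using Pw qm p by (simp_all add: scalar_product_3)
    show "vector [0, y, 1] \<in> F \<longleftrightarrow> y = m" for y
    proof
      assume "vector [0, y, 1] \<in> F"
      then have "of_int q * y + \<gamma> = 0" unfolding F_def by (simp add: scalar_product_3)
      then have "of_int q * y = of_int q * m" using qm by (metis add_right_cancel)
      then show "y = m" using c(2) by simp
    qed (use Pm qm in \<open>simp add: F_def scalar_product_3\<close>)
  qed
  ultimately show thesis using that[of F m] km k md by simp
qed

section \<open>Contradiction with finiteness\<close>

theorem theorem4p4:
  fixes a \<delta> :: "'a::linordered_field" and \<Sigma> :: "('a ^ 3) set set"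
  assumes "\<not> archimedean TYPE('a)"
    and "0 < a" and "0 < \<delta>" and "\<delta> \<lless> a"
    and "admissible_fan \<Sigma>"
    and "maximal_cones \<Sigma> =
      {{v\<in>upper_half_space. v $ 1 = 0 \<and> v $ 2 = \<delta> * v $ 3},
       {v\<in>upper_half_space. v $ 2 = 0 \<and> - (a * v $ 3) \<le> v $ 1 \<and> v $ 1 \<le> a * v $ 3}}"
  shows "\<not> (\<exists>\<Sigma>'. admissible_completion \<Sigma>' \<Sigma>)"
proof
  assume "\<exists>\<Sigma>'. admissible_completion \<Sigma>' \<Sigma>"
  then obtain \<Sigma>' where comp: "admissible_completion \<Sigma>' \<Sigma>" ..
  have fan: "admissible_fan \<Sigma>'" and sub: "\<Sigma> \<subseteq> \<Sigma>'" and cover: "\<Union>\<Sigma>' = upper_half_space"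
    using comp unfolding admissible_completion_def by simp_all
  have max: "maximal_cones \<Sigma> = {ray_cone \<delta>, wedge_cone a}"
    unfolding ray_cone_def wedge_cone_def by (rule assms(6))
  have "maximal_cones \<Sigma> \<subseteq> \<Sigma>" unfolding maximal_cones_def by blast
  then have ray: "ray_cone \<delta> \<in> \<Sigma>'" and wedge: "wedge_cone a \<in> \<Sigma>'" using max sub by auto
  define G where "G = {h. 0 \<le> h \<and> h < \<delta> \<and> (\<exists>E\<in>\<Sigma>'. wide_edge \<delta> E h)}"
  \<comment> \<open>A cone carries at most one height, so finitely many cones allow only finitely
    many heights. Cones that are not wide edges may take any value under \<open>THE\<close>.\<close>
  have "G \<subseteq> (\<lambda>E. THE h. vector [0, h, 1] \<in> E) ` \<Sigma>'"
  proof
    fix h assume "h \<in> G"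
    then obtain E where E: "E \<in> \<Sigma>'" "wide_edge \<delta> E h" unfolding G_def by blast
    then have "(THE h. vector [0, h, 1] \<in> E) = h" unfolding wide_edge_def by simp
    then show "h \<in> (\<lambda>E. THE h. vector [0, h, 1] \<in> E) ` \<Sigma>'" using E(1) by force
  qed
  moreover have "finite \<Sigma>'" using fan fan_finite by (auto simp: admissible_fan_def)
  ultimately have fin: "finite G" by (meson finite_imageI finite_subset)
  \<comment> \<open>The bottom rung has half-width \<open>a\<close>; here
    \<open>\<delta> \<lless> a\<close> enters.\<close>
  have "wide_edge \<delta> (wedge_cone a) 0"
    unfolding wide_edge_def wedge_cone_def upper_half_space_def
    using assms(2,4) by (auto intro!: exI[of _ a])
  then have "0 \<in> G" unfolding G_def using assms(3) wedge by auto
  then have "Max G \<in> G" using fin Max_in by blast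
  then obtain E where E: "E \<in> \<Sigma>'" "wide_edge \<delta> E (Max G)" "0 \<le> Max G" "Max G < \<delta>"
    unfolding G_def by blast
  obtain F h' where F: "F \<in> \<Sigma>'" "wide_edge \<delta> F h'" "Max G < h'" "h' < \<delta>"
    using wide_edge_higher[OF fan cover ray assms(3) E] by metis
  have "0 \<le> h'" using E(3) F(3) by linarith
  then have "h' \<in> G" unfolding G_def using F by blast
  then show False using Max_ge[OF fin] F(3) by (meson leD)
qed

end
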